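(* Let $T$ be a total order on the sample space $\Omega$ and let $B_T^*$ be the conditionally optimal lower bound for $T$. Then $B_T^*$ is admissible (with respect to the set of all lower bounds on $\Omega$) if and only if for any other total order $U$ on $\Omega$ with which $B_T^*$ is consistent, with conditionally optimal bound $B_U^*$, one has $B_T^* = B_U^*$.
   Context: Fix a finite nonempty set $S\subset\mathbb{R}$, an integer $n\ge 1$ and $\alpha\in(0,1)$ (the confidence level is $1-\alpha$). The sample space is $\Omega=\Omega(S,n)=\{(x_1,\dots,x_n)\in S^n: x_1\le\dots\le x_n\}$, with $N=|\Omega|$. $\mathcal{F}=\mathcal{F}(S)$ is the closed simplex of all probability distributions on $S$ (zero masses allowed), with the Euclidean topology on mass vectors, and $\mu(F)=\sum_{s\in S}sF(s)$. For $x\in\Omega$ containing $\hat x_s$ copies of $s$, $\Pr_F(x)=\frac{n!}{\prod_{s}\hat x_s!}\prod_{s\in S}F(s)^{\hat x_s}$ (with $0^0=1$), and $\Pr_F(A)=\sum_{x\in A}\Pr_F(x)$ for $A\subseteq\Omega$. A lower bound is any map $B:\Omega\to[-\infty,\infty]$. It is valid if $\Pr_F(\{x\in\Omega: B(x)>\mu(F)\})\le\alpha$ for every $F\in\mathcal{F}$. For valid bounds, $B_1$ dominates $B_2$ if $B_1(x)\ge B_2(x)$ for all $x\in\Omega$ with strict inequality for at least one $x$. A bound $B$ is admissible if it is valid and no valid bound dominates it. A total order $T$ on $\Omega$ is an enumeration $(x_{t_1},\dots,x_{t_N})$ of $\Omega$; a bound $B$ is consistent with $T$ if $B(x_{t_1})\le\dots\le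 B(x_{t_N})$. The conditionally optimal bound $B_T^*$ for $T$ is the (unique) valid bound consistent with $T$ that dominates every other valid bound consistent with $T$. Classically (Buehler) it exists and is given by $B_T^*(x_{t_k})=\min_{F\in\mathcal{F}_k}\mu(F)$ if $\mathcal{F}_k\neq\emptyset$ and $B_T^*(x_{t_k})=\infty$ if $\mathcal{F}_k=\emptyset$, where $\Omega_k=\{x_{t_k},\dots,x_{t_N}\}$ and $\mathcal{F}_k$ is the closure of $\{F\in\mathcal{F}:\Pr_F(\Omega_k)>\alpha\}$. *)

theory Defs
  imports "HOL-Probability.Probability"
begin

definition sample_space :: "real set \<Rightarrow> nat \<Rightarrow> real list set" where
  "sample_space S n = {x. length x = n \<and> set x \<subseteq> S \<and> sorted x}"

definition distributions :: "real set \<Rightarrow> real pmf set" where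
  "distributions S = {F. set_pmf F \<subseteq> S}"

definition mu :: "real set \<Rightarrow> real pmf \<Rightarrow> real" where
  "mu S F = (\<Sum>s\<in>S. s * pmf F s)"

text \<open>
  A point of the sample space is an ordered sample, so its probability under \<open>n\<close> independent
  draws from \<open>F\<close> is the multinomial probability of the vector of its multiplicities.
\<close>

definition pr_point :: "real set \<Rightarrow> nat \<Rightarrow> real pmf \<Rightarrow> real list \<Rightarrow> real" where
  "pr_point S n F x =
     fact n / (\<Prod>s\<in>S. fact (count_list x s)) * (\<Prod>s\<in>S. pmf F s ^ count_list x s)"

definition pr :: "real set \<Rightarrow> nat \<Rightarrow> real pmf \<Rightarrow> real list set \<Rightarrow> real" where
  "pr S n F A = (\<Sum>x\<in>A. pr_point S n F x)"

text \<open>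
  Bounds are extensional (equal to \<open>undefined\<close> off the sample space), so that equality of bounds
  is equality of maps on the sample space.
\<close>

definition lower_bounds :: "real set \<Rightarrow> nat \<Rightarrow> (real list \<Rightarrow> ereal) set" where
  "lower_bounds S n = (sample_space S n \<rightarrow>\<^sub>E UNIV)"

definition valid_bound :: "real set \<Rightarrow> nat \<Rightarrow> real \<Rightarrow> (real list \<Rightarrow> ereal) \<Rightarrow> bool" where
  "valid_bound S n \<alpha> B \<longleftrightarrow>
     B \<in> lower_bounds S n \<and>
     (\<forall>F\<in>distributions S. pr S n F {x \<in> sample_space S n. B x > ereal (mu S F)} \<le> \<alpha>)"

definition dominates ::
  "real set \<Rightarrow> nat \<Rightarrow> (real list \<Rightarrow> ereal) \<Rightarrow> (real list \<Rightarrow> ereal) \<Rightarrow> bool" where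
  "dominates S n B1 B2 \<longleftrightarrow>
     (\<forall>x\<in>sample_space S n. B1 x \<ge> B2 x) \<and> (\<exists>x\<in>sample_space S n. B1 x > B2 x)"

definition admissible_bound :: "real set \<Rightarrow> nat \<Rightarrow> real \<Rightarrow> (real list \<Rightarrow> ereal) \<Rightarrow> bool" where
  "admissible_bound S n \<alpha> B \<longleftrightarrow>
     valid_bound S n \<alpha> B \<and> \<not> (\<exists>B'. valid_bound S n \<alpha> B' \<and> dominates S n B' B)"

text \<open>A total order is given by the list that enumerates the sample space in increasing order.\<close>

definition total_order_of :: "real set \<Rightarrow> nat \<Rightarrow> real list list \<Rightarrow> bool" where
  "total_order_of S n T \<longleftrightarrow> distinct T \<and> set T = sample_space S n"

definition consistent_with :: "(real list \<Rightarrow> ereal) \<Rightarrow> real list list \<Rightarrow> bool" where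
  "consistent_with B T \<longleftrightarrow> sorted (map B T)"

definition is_cond_optimal ::
  "real set \<Rightarrow> nat \<Rightarrow> real \<Rightarrow> real list list \<Rightarrow> (real list \<Rightarrow> ereal) \<Rightarrow> bool" where
  "is_cond_optimal S n \<alpha> T B \<longleftrightarrow>
     valid_bound S n \<alpha> B \<and> consistent_with B T \<and>
     (\<forall>B'. valid_bound S n \<alpha> B' \<and> consistent_with B' T \<and> B' \<noteq> B \<longrightarrow> dominates S n B B')"

definition cond_optimal_bound ::
  "real set \<Rightarrow> nat \<Rightarrow> real \<Rightarrow> real list list \<Rightarrow> real list \<Rightarrow> ereal" where
  "cond_optimal_bound S n \<alpha> T = (THE B. is_cond_optimal S n \<alpha> T B)"

lemma finite_sample_space: "finite S \<Longrightarrow> finite (sample_space S n)"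
  by (rule finite_subset[OF _ finite_lists_length_eq[of S n]]) (auto simp: sample_space_def)

lemma pr_point_nonneg: "0 \<le> pr_point S n F x"
  unfolding pr_point_def by (intro mult_nonneg_nonneg divide_nonneg_nonneg prod_nonneg) auto

lemma pr_mono:
  assumes "finite S" "A \<subseteq> B" "B \<subseteq> sample_space S n"
  shows "pr S n F A \<le> pr S n F B"
  unfolding pr_def using assms finite_subset[OF _ finite_sample_space[OF assms(1)]]
  by (intro sum_mono2) (auto simp: pr_point_nonneg)

lemma dominatesI:
  assumes "B \<in> lower_bounds S n" "B' \<in> lower_bounds S n" "B' \<noteq> B"
    and le: "\<And>x. x \<in> sample_space S n \<Longrightarrow> B' x \<le> B x"
  shows "dominates S n B B'"
proof -
  have "\<exists>x\<in>sample_space S n. B' x \<noteq> B x"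
    using assms(1-3) unfolding lower_bounds_def by (metis PiE_ext)
  thus ?thesis unfolding dominates_def using le by (force simp: order.order_iff_strict)
qed

text \<open>
  Existence and uniqueness of the conditionally optimal bound: it is the pointwise supremum of the
  valid bounds consistent with the order.
\<close>

lemma ex1_is_cond_optimal:
  assumes "finite S" "0 < \<alpha>" "total_order_of S n T"
  shows "\<exists>!B. is_cond_optimal S n \<alpha> T B"
proof -
  let ?\<Omega> = "sample_space S n"
  define V where "V = {B. valid_bound S n \<alpha> B \<and> consistent_with B T}"
  define M where "M = restrict (\<lambda>x. SUP B\<in>V. B x) ?\<Omega>"
  have T: "set T = ?\<Omega>" using assms(3) by (simp add: total_order_of_def)
  have M_lb: "M \<in> lower_bounds S n" by (simp add: M_def lower_bounds_def)
  have V_le: "B x \<le> M x" if "B \<in> V" "x \<in> ?\<Omega>" for B x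
    using that by (auto simp: M_def intro: SUP_upper)
  have mono: "B (T ! i) \<le> B (T ! j)" if "B \<in> V" "i \<le> j" "j < length T" for B i j
    using that by (auto simp: V_def consistent_with_def sorted_iff_nth_mono)
  have M_cons: "consistent_with M T"
    unfolding consistent_with_def sorted_iff_nth_mono
  proof (intro allI impI)
    fix i j assume ij: "i \<le> j" "j < length (map M T)"
    have "T ! i \<in> ?\<Omega>" "T ! j \<in> ?\<Omega>" using ij T nth_mem[of _ T] by auto
    thus "map M T ! i \<le> map M T ! j"
      using ij by (auto simp: M_def intro!: SUP_mono mono)
  qed
  have M_valid: "valid_bound S n \<alpha> M"
    unfolding valid_bound_def
  proof (intro conjI ballI M_lb)
    fix F assume F: "F \<in> distributions S"
    let ?A = "{x \<in> ?\<Omega>. M x > ereal (mu S F)}"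
    show "pr S n F ?A \<le> \<alpha>"
    proof (cases "?A = {}")
      case True
      thus ?thesis using assms(2) by (metis pr_def sum.empty less_imp_le)
    next
      case False
      define k where "k = (LEAST k. k < length T \<and> T ! k \<in> ?A)"
      have ex: "\<exists>k. k < length T \<and> T ! k \<in> ?A"
        using False T by (metis (no_types, lifting) all_not_in_conv in_set_conv_nth mem_Collect_eq)
      have k: "k < length T" "T ! k \<in> ?A" using LeastI_ex[OF ex] by (auto simp: k_def)
      have "ereal (mu S F) < (SUP B\<in>V. B (T ! k))" using k by (auto simp: M_def split: if_splits)
      then obtain B where B: "B \<in> V" "ereal (mu S F) < B (T ! k)" by (auto simp: less_SUP_iff)
      have "?A \<subseteq> {x \<in> ?\<Omega>. B x > ereal (mu S F)}"
      proof
        fix x assume x: "x \<in> ?A"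
        then obtain j where j: "j < length T" "x = T ! j" using T by (metis (no_types, lifting) in_set_conv_nth mem_Collect_eq)
        have "k \<le> j" unfolding k_def using x j by (intro Least_le) auto
        thus "x \<in> {x \<in> ?\<Omega>. B x > ereal (mu S F)}"
          using mono[OF B(1) _ j(1)] B(2) x j(2) by (auto intro: less_le_trans)
      qed
      hence "pr S n F ?A \<le> pr S n F {x \<in> ?\<Omega>. B x > ereal (mu S F)}"
        by (intro pr_mono assms(1)) auto
      also have "\<dots> \<le> \<alpha>" using B(1) F by (simp add: V_def valid_bound_def)
      finally show ?thesis .
    qed
  qed
  have opt: "is_cond_optimal S n \<alpha> T M"
    unfolding is_cond_optimal_def
  proof (intro conjI M_valid M_cons allI impI)
    fix B' assume B': "valid_bound S n \<alpha> B' \<and> consistent_with B' T \<and> B' \<noteq> M"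
    show "dominates S n M B'"
      using B' by (intro dominatesI M_lb V_le) (auto simp: V_def valid_bound_def)
  qed
  show ?thesis
  proof (rule ex1I[of _ M], rule opt)
    fix B assume B: "is_cond_optimal S n \<alpha> T B"
    show "B = M"
    proof (rule ccontr)
      assume "B \<noteq> M"
      hence "dominates S n M B" "dominates S n B M"
        using B opt unfolding is_cond_optimal_def by auto
      thus False unfolding dominates_def by (meson leD)
    qed
  qed
qed

end

theory Submission imports Defs begin

text \<open>
  Admissibility compares a bound \<open>B\<close> with all valid bounds, conditional optimality only with those
  consistent with one order. The two meet because a total order that \<open>B\<close> respects leaves the points
  inside a level set of \<open>B\<close> in arbitrary order. If a valid bound \<open>B'\<close> dominates \<open>B\<close> and exceeds it
  at \<open>x\<^sub>0\<close>, raise \<open>B\<close> at \<open>x\<^sub>0\<close> alone, to a value \<open>c\<close> below both \<open>B' x\<^sub>0\<close> and every value of \<open>B\<close>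
  greater than \<open>B x\<^sub>0\<close>. Lying below \<open>B'\<close>, the raised bound is valid; and since \<open>x\<^sub>0\<close> does not reach
  the next level of \<open>B\<close>, sorting the sample space by the raised bound gives an order with which
  both bounds are consistent (lemma \<open>inadmissible_imp_improvable_along_order\<close>). For that order \<open>B\<close>
  is not optimal, so an inadmissible bound always fails the comparison of orders. Conversely, a
  different optimal bound for an order that \<open>B\<close> respects dominates \<open>B\<close>.
\<close>

text \<open>The event of overshooting the mean shrinks when the bound decreases.\<close>

lemma valid_bound_antimono:
  assumes "finite S" "valid_bound S n \<alpha> B'" "B \<in> lower_bounds S n"
    and le: "\<And>x. x \<in> sample_space S n \<Longrightarrow> B x \<le> B' x"
  shows "valid_bound S n \<alpha> B"
  unfolding valid_bound_def
proof (intro conjI ballI assms(3))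
  fix F assume F: "F \<in> distributions S"
  have "pr S n F {x \<in> sample_space S n. B x > ereal (mu S F)}
      \<le> pr S n F {x \<in> sample_space S n. B' x > ereal (mu S F)}"
    using le by (intro pr_mono assms(1)) (auto intro: less_le_trans)
  also have "\<dots> \<le> \<alpha>"
    using assms(2) F by (simp add: valid_bound_def)
  finally show "pr S n F {x \<in> sample_space S n. B x > ereal (mu S F)} \<le> \<alpha>" .
qed

lemma cond_optimal_bound_is_cond_optimal:
  assumes "finite S" "0 < \<alpha>" "total_order_of S n T"
  shows "is_cond_optimal S n \<alpha> T (cond_optimal_bound S n \<alpha> T)"
  unfolding cond_optimal_bound_def by (rule theI'[OF ex1_is_cond_optimal[OF assms]])

lemma consistent_with_sort_key:
  assumes "\<And>x y. x \<in> set T \<Longrightarrow> y \<in> set T \<Longrightarrow> C x \<le> C y \<Longrightarrow> B x \<le> B y"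
  shows "consistent_with B (sort_key C T)"
proof -
  have "sorted_wrt (\<lambda>x y. C x \<le> C y) (sort_key C T)"
    using sorted_sort_key[of C T] by (simp add: sorted_map)
  hence "sorted_wrt (\<lambda>x y. B x \<le> B y) (sort_key C T)"
    by (rule sorted_wrt_mono_rel[rotated]) (auto intro: assms)
  thus ?thesis
    by (simp add: consistent_with_def sorted_map)
qed

text \<open>
  A dominating bound \<open>B'\<close> may rank the points differently from \<open>B\<close> and so be consistent with none of
  the orders that \<open>B\<close> respects. Raising a single point by a small amount retains an improvement
  while preserving every strict inequality between values of \<open>B\<close>.
\<close>

lemma inadmissible_imp_improvable_along_order:
  assumes "finite S" "total_order_of S n T" "valid_bound S n \<alpha> B"
    and inadm: "\<not> admissible_bound S n \<alpha> B"
  obtains U C where "total_order_of S n U" "consistent_with B U" "consistent_with C U"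
    "valid_bound S n \<alpha> C" "dominates S n C B"
proof -
  let ?\<Omega> = "sample_space S n"
  obtain B' x0 where B': "valid_bound S n \<alpha> B'" and ge: "\<And>x. x \<in> ?\<Omega> \<Longrightarrow> B x \<le> B' x"
    and x0: "x0 \<in> ?\<Omega>" "B x0 < B' x0"
    using inadm assms(3) unfolding admissible_bound_def dominates_def by blast
  define M where "M = insert (B' x0) {B y |y. y \<in> ?\<Omega> \<and> B x0 < B y}"
  have M: "finite M" "M \<noteq> {}" "\<And>m. m \<in> M \<Longrightarrow> B x0 < m"
    using finite_sample_space[OF assms(1), of n] x0 by (auto simp: M_def)
  hence "B x0 < Min M" by simp
  \<comment> \<open>Strictness on the right matters: with \<open>c\<close> equal to the next value of \<open>B\<close>, sorting by the raised
      bound could place \<open>x0\<close> after points where \<open>B\<close> is larger.\<close>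
  then obtain c where c: "B x0 < c" "c < Min M" using dense by blast
  hence c_less: "c < m" if "m \<in> M" for m
    using that M(1) Min_le less_le_trans by blast
  define C where "C = B(x0 := c)"
  define U where "U = sort_key C T"
  have order_U: "total_order_of S n U"
    using assms(2) by (simp add: U_def total_order_of_def)
  have reflects: "B x \<le> B y" if "x \<in> ?\<Omega>" "y \<in> ?\<Omega>" "C x \<le> C y" for x y
  proof (rule ccontr)
    assume "\<not> B x \<le> B y"
    hence less: "B y < B x" by simp
    show False
    proof (cases "y = x0")
      case True
      hence "c < B x" using that(1) less by (intro c_less) (auto simp: M_def)
      thus False using that(3) True less by (auto simp: C_def split: if_splits)
    next
      case False
      hence "C y < C x" using less c(1) by (auto simp: C_def)
      thus False using that(3) by simp
    qed
  qed
  have "consistent_with B U"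
    unfolding U_def using assms(2)
    by (intro consistent_with_sort_key reflects) (auto simp: total_order_of_def)
  moreover have "consistent_with C U"
    unfolding U_def by (rule consistent_with_sort_key)
  moreover have "valid_bound S n \<alpha> C"
  proof (rule valid_bound_antimono[OF assms(1) B'])
    show "C \<in> lower_bounds S n"
      using assms(3) x0(1) by (auto simp: C_def valid_bound_def lower_bounds_def PiE_iff extensional_def)
    show "C x \<le> B' x" if "x \<in> ?\<Omega>" for x
      using ge[OF that] c_less[of "B' x0"] by (auto simp: C_def M_def)
  qed
  moreover have "dominates S n C B"
    using x0(1) c(1) by (auto simp: C_def dominates_def)
  ultimately show thesis using that order_U by blast
qed

theorem theorem3p9:
  fixes S :: "real set" and n :: nat and \<alpha> :: real and T :: "real list list"
  assumes "finite S" and "S \<noteq> {}" and "n \<ge> 1" and "0 < \<alpha>" and "\<alpha> < 1"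
    and "total_order_of S n T"
  shows "admissible_bound S n \<alpha> (cond_optimal_bound S n \<alpha> T) \<longleftrightarrow>
    (\<forall>U. total_order_of S n U \<and> U \<noteq> T \<and> consistent_with (cond_optimal_bound S n \<alpha> T) U
      \<longrightarrow> cond_optimal_bound S n \<alpha> T = cond_optimal_bound S n \<alpha> U)"
    (is "admissible_bound S n \<alpha> ?B \<longleftrightarrow> ?unique")
proof
  have opt: "is_cond_optimal S n \<alpha> U (cond_optimal_bound S n \<alpha> U)" if "total_order_of S n U" for U
    using cond_optimal_bound_is_cond_optimal[OF assms(1,4) that] .
  have valid: "valid_bound S n \<alpha> ?B"
    using opt[OF assms(6)] by (simp add: is_cond_optimal_def)
  show ?unique if adm: "admissible_bound S n \<alpha> ?B"
  proof (intro allI impI, elim conjE)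
    fix U assume U: "total_order_of S n U" "consistent_with ?B U"
    show "?B = cond_optimal_bound S n \<alpha> U"
      using adm opt[OF U(1)] U(2) valid unfolding is_cond_optimal_def admissible_bound_def by blast
  qed
  show "admissible_bound S n \<alpha> ?B" if unique: ?unique
  proof (rule ccontr)
    assume "\<not> admissible_bound S n \<alpha> ?B"
    then obtain U C where U: "total_order_of S n U" "consistent_with ?B U"
      and C: "consistent_with C U" "valid_bound S n \<alpha> C" "dominates S n C ?B"
      using inadmissible_imp_improvable_along_order[OF assms(1,6) valid] by blast
    have "?B = cond_optimal_bound S n \<alpha> U"
      using unique U by (cases "U = T") auto
    hence "is_cond_optimal S n \<alpha> U ?B" using opt[OF U(1)] by simp
    moreover have "C \<noteq> ?B" using C(3) by (auto simp: dominates_def)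
    ultimately have "dominates S n ?B C" using C unfolding is_cond_optimal_def by blast
    thus False using C(3) unfolding dominates_def by (meson leD)
  qed
qed

end
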